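(* Let $W_4$ be the wheel graph with four spokes. For every real $\beta>1$, the function $T_{W_4}^{-\beta}$ is completely monotone on its positive edge cone $(0,\infty)^{E(W_4)}$. Hence $W_4\in\mathcal{G}_\beta$ for every $1<\beta<3/2$.
   Context: The wheel $W_4$ has five vertices $0,1,2,3,4$: a hub $0$ joined to each of the rim vertices $1,2,3,4$, together with the rim cycle $1-2-3-4-1$ (eight edges in total). For a finite connected graph $G=(V,E)$, the spanning-tree polynomial is $T_G(x)=\sum_{T\in\mathcal{T}(G)}\prod_{e\in T}x_e$, $x=(x_e)_{e\in E}$, where $\mathcal{T}(G)$ is the set of spanning trees of $G$. A function $f\in C^\infty((0,\infty)^n)$ is completely monotone if $(-1)^{|\alpha|}\partial^\alpha f(x)\ge 0$ for all multi-indices $\alpha\in\mathbb{N}^n$ and all $x\in(0,\infty)^n$. For $\beta>0$, $\mathcal{G}_\beta$ denotes the class of finite connected graphs $G$ such that $T_G^{-\beta}$ is completely monotone on $(0,\infty)^E$. *)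

theory Defs
  imports "HOL-Analysis.Analysis"
begin

section \<open>Complete monotonicity on a positive orthant\<close>

text \<open>
  For a finite index set \<open>I\<close>, the space \<open>(0,\<infinity>)^I\<close> consists of the extensional functions
  on \<open>I\<close>.  Its topology as a subset of \<open>'a \<Rightarrow> real\<close> (product topology) is the Euclidean one.
\<close>

definition pos_orthant :: "'a set \<Rightarrow> ('a \<Rightarrow> real) set" where
  "pos_orthant I = I \<rightarrow>\<^sub>E {0<..}"

definition partial_deriv :: "'a \<Rightarrow> (('a \<Rightarrow> real) \<Rightarrow> real) \<Rightarrow> ('a \<Rightarrow> real) \<Rightarrow> real" where
  "partial_deriv i f x = deriv (\<lambda>t. f (x(i := t))) (x i)"

definition iter_partial :: "'a list \<Rightarrow> (('a \<Rightarrow> real) \<Rightarrow> real) \<Rightarrow> ('a \<Rightarrow> real) \<Rightarrow> real" where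
  "iter_partial js f = foldr partial_deriv js f"

text \<open>
  Since \<open>deriv\<close> is total, existence of each iterated partial derivative is required separately.
\<close>

definition smooth_on_orthant :: "'a set \<Rightarrow> (('a \<Rightarrow> real) \<Rightarrow> real) \<Rightarrow> bool" where
  "smooth_on_orthant I f \<longleftrightarrow>
     (\<forall>js \<in> lists I.
        continuous_on (pos_orthant I) (iter_partial js f) \<and>
        (\<forall>i \<in> I. \<forall>x \<in> pos_orthant I.
           (\<lambda>t. iter_partial js f (x(i := t))) field_differentiable at (x i)))"

text \<open>
  A list \<open>js\<close> in which each \<open>i \<in> I\<close> occurs \<open>\<alpha> i\<close> times is one order in which the partial
  derivatives making up \<open>\<partial>^\<alpha>\<close> can be taken; for smooth functions the order is irrelevant, so no
  particular one is singled out.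
\<close>

definition completely_monotone :: "'a set \<Rightarrow> (('a \<Rightarrow> real) \<Rightarrow> real) \<Rightarrow> bool" where
  "completely_monotone I f \<longleftrightarrow>
     smooth_on_orthant I f \<and>
     (\<forall>\<alpha> :: 'a \<Rightarrow> nat. \<forall>js \<in> lists I. (\<forall>i \<in> I. count_list js i = \<alpha> i) \<longrightarrow>
        (\<forall>x \<in> pos_orthant I. 0 \<le> (- 1) ^ (\<Sum>i\<in>I. \<alpha> i) * iter_partial js f x))"


section \<open>Graphs and spanning-tree polynomials\<close>

type_synonym 'v ugraph = "'v set \<times> 'v set set"

abbreviation vertices :: "'v ugraph \<Rightarrow> 'v set" where "vertices \<equiv> fst"
abbreviation edges :: "'v ugraph \<Rightarrow> 'v set set" where "edges \<equiv> snd"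

definition finite_graph :: "'v ugraph \<Rightarrow> bool" where
  "finite_graph G \<longleftrightarrow> finite (vertices G) \<and> (\<forall>e \<in> edges G. e \<subseteq> vertices G \<and> card e = 2)"

definition connected_graph :: "'v ugraph \<Rightarrow> bool" where
  "connected_graph G \<longleftrightarrow> vertices G \<noteq> {} \<and>
     (\<forall>u \<in> vertices G. \<forall>v \<in> vertices G. (u, v) \<in> {(a, b). {a, b} \<in> edges G}\<^sup>*)"

definition is_cycle :: "'v ugraph \<Rightarrow> 'v list \<Rightarrow> bool" where
  "is_cycle G p \<longleftrightarrow> 3 \<le> length p \<and> distinct p \<and>
     (\<forall>i < length p. {p ! i, p ! (Suc i mod length p)} \<in> edges G)"

definition is_tree :: "'v ugraph \<Rightarrow> bool" where
  "is_tree G \<longleftrightarrow> connected_graph G \<and> (\<nexists>p. is_cycle G p)"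

definition spanning_trees :: "'v ugraph \<Rightarrow> 'v set set set" where
  "spanning_trees G = {T. T \<subseteq> edges G \<and> is_tree (vertices G, T)}"

definition tree_poly :: "'v ugraph \<Rightarrow> ('v set \<Rightarrow> real) \<Rightarrow> real" where
  "tree_poly G x = (\<Sum>T \<in> spanning_trees G. \<Prod>e \<in> T. x e)"

definition cm_graphs :: "real \<Rightarrow> 'v ugraph set" where
  "cm_graphs \<beta> = {G. finite_graph G \<and> connected_graph G \<and>
     completely_monotone (edges G) (\<lambda>x. tree_poly G x powr (- \<beta>))}"

definition W4 :: "nat ugraph" where
  "W4 = ({0, 1, 2, 3, 4},
         {{0, 1}, {0, 2}, {0, 3}, {0, 4}, {1, 2}, {2, 3}, {3, 4}, {4, 1}})"

end

theory Submission
  imports Defs "HOL-Probability.Distributions"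
begin

text \<open>
  Delete the row and column of the hub from the weighted Laplacian of \<open>W\<^sub>4\<close>, so that \<open>T\<close> is the
  determinant of a \<open>4 \<times> 4\<close> matrix.  The rim vertices \<open>1\<close> and \<open>3\<close> are not adjacent, so eliminating them
  gives \<open>T = a c det D\<close>, where \<open>a\<close>, \<open>c\<close> are their weighted degrees and \<open>D\<close> is the \<open>2 \<times> 2\<close> Schur
  complement on the vertices \<open>2\<close> and \<open>4\<close>.  The power \<open>(det D)\<^sup>-\<^sup>\<beta>\<close> is the integral of
  \<open>exp (- tr (S D))\<close> over a Wishart-type measure on positive semidefinite \<open>2 \<times> 2\<close> matrices \<open>S\<close>.
  The corrections in \<open>D\<close> produce factors \<open>exp (b\<^sup>T S b / a)\<close>; such a factor times \<open>1 / a\<close> is a Gaussian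
  integral over two variables, and the remaining power \<open>a\<^sup>1\<^sup>-\<^sup>\<beta>\<close> is a Gamma integral since \<open>\<beta> > 1\<close>.
  Altogether \<open>T\<^sup>-\<^sup>\<beta>\<close> is the integral of \<open>exp (- (\<Sum>e. x\<^sub>e c\<^sub>e))\<close> against a positive measure with all
  \<open>c\<^sub>e \<ge> 0\<close>, and differentiating under the integral sign gives complete monotonicity.
\<close>

section \<open>Laplace transforms of positive measures\<close>

text \<open>Multiplying \<open>1 - v \<le> exp (- v)\<close> by \<open>exp v\<close> gives
  \<open>exp v - 1 \<le> v * exp v\<close>, so the remainder is at most
  \<open>v * (exp v - 1)\<close>. The two signs of \<open>v\<close> then use the upper and the lower
  bound for \<open>exp v - 1\<close>.\<close>

lemma exp_remainder_bounds:
  fixes v :: real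
  shows "0 \<le> exp v - 1 - v" and "exp v - 1 - v \<le> v\<^sup>2 * max 1 (exp v)"
proof -
  show "0 \<le> exp v - 1 - v" using exp_ge_add_one_self[of v] by linarith
  have "1 - v \<le> exp (- v)" using exp_ge_add_one_self[of "- v"] by simp
  then have "(1 - v) * exp v \<le> exp (- v) * exp v" by (intro mult_right_mono) auto
  then have up: "exp v - 1 \<le> v * exp v" by (simp add: algebra_simps exp_minus)
  have lo: "v \<le> exp v - 1" using exp_ge_add_one_self[of v] by linarith
  have *: "exp v - 1 - v \<le> v * (exp v - 1)" using up by (simp add: algebra_simps)
  show "exp v - 1 - v \<le> v\<^sup>2 * max 1 (exp v)"
  proof (cases "0 \<le> v")
    case True
    have "v * (exp v - 1) \<le> v * (v * exp v)" using True up by (intro mult_left_mono) auto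
    also have "\<dots> \<le> v\<^sup>2 * max 1 (exp v)"
      unfolding power2_eq_square mult.assoc[symmetric] by (intro mult_left_mono) auto
    finally show ?thesis using * by linarith
  next
    case False
    have "v * (exp v - 1) \<le> v * v" using False lo by (intro mult_left_mono_neg) auto
    also have "\<dots> \<le> v\<^sup>2 * max 1 (exp v)"
      by (simp add: power2_eq_square mult_le_cancel_left1 max_def)
    finally show ?thesis using * by linarith
  qed
qed

text \<open>Factoring out \<open>exp (- b)\<close> reduces this to the remainder at
  \<open>v = b - a\<close>, and \<open>exp (- b) * max 1 (exp v)\<close> is the larger of
  \<open>exp (- a)\<close> and \<open>exp (- b)\<close>. In the application \<open>m\<close> is the
  phase at a smaller point, which makes the bound integrable.\<close>

lemma exp_minus_taylor_bound:
  fixes a b m :: real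
  assumes "m \<le> a" "m \<le> b"
  shows "\<bar>exp (- a) - exp (- b) + (a - b) * exp (- b)\<bar> \<le> (a - b)\<^sup>2 * exp (- m)"
proof -
  define v where "v = b - a"
  have eq: "exp (- a) - exp (- b) + (a - b) * exp (- b) = exp (- b) * (exp v - 1 - v)"
    by (simp add: v_def algebra_simps exp_diff exp_minus divide_simps)
  have "exp (- b) * (exp v - 1 - v) \<le> exp (- b) * (v\<^sup>2 * max 1 (exp v))"
    using exp_remainder_bounds(2)[of v] by (intro mult_left_mono) auto
  also have "\<dots> = v\<^sup>2 * max (exp (- b)) (exp (- a))"
    by (auto simp: max_def v_def exp_diff exp_minus divide_simps)
  also have "\<dots> \<le> v\<^sup>2 * exp (- m)"
    using assms by (intro mult_left_mono) auto
  finally show ?thesis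
    using exp_remainder_bounds(1)[of v] unfolding eq
    by (simp add: abs_mult v_def power2_commute)
qed

text \<open>By symmetry \<open>a \<le> b\<close>; then factor out \<open>exp (- a)\<close> and use
  \<open>1 - exp (- h) \<le> h\<close> with \<open>h = b - a\<close>.\<close>

lemma exp_minus_lipschitz_bound:
  fixes a b m :: real
  assumes "m \<le> a" "m \<le> b"
  shows "\<bar>exp (- a) - exp (- b)\<bar> \<le> \<bar>a - b\<bar> * exp (- m)"
proof -
  have *: "exp (- a) - exp (- b) \<le> (b - a) * exp (- m)" if "a \<le> b" "m \<le> a" for a b :: real
  proof -
    have "exp (- a) - exp (- b) = exp (- a) * (1 - exp (- (b - a)))"
      by (simp add: algebra_simps exp_minus exp_diff divide_simps)
    also have "\<dots> \<le> exp (- a) * (b - a)"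
      using exp_ge_add_one_self[of "a - b"] by (intro mult_left_mono) (simp_all add: algebra_simps)
    also have "\<dots> \<le> exp (- m) * (b - a)"
      using that by (intro mult_right_mono) auto
    finally show ?thesis by (simp add: mult.commute)
  qed
  show ?thesis
    using *[of a b] *[of b a] assms by (cases "a \<le> b") auto
qed

lemma abs_integral_le:
  fixes f g :: "'b \<Rightarrow> real"
  assumes "integrable M f" "integrable M g" "\<And>x. \<bar>f x\<bar> \<le> g x"
  shows "\<bar>\<integral>x. f x \<partial>M\<bar> \<le> (\<integral>x. g x \<partial>M)"
  using assms by (intro order.trans[OF integral_abs_bound] integral_mono) auto

lemma pos_orthantD: "x \<in> pos_orthant I \<Longrightarrow> i \<in> I \<Longrightarrow> 0 < x i"
  by (auto simp: pos_orthant_def PiE_iff)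

lemma pos_orthant_upd: "x \<in> pos_orthant I \<Longrightarrow> i \<in> I \<Longrightarrow> 0 < t \<Longrightarrow> x(i := t) \<in> pos_orthant I"
  by (auto simp: pos_orthant_def PiE_iff extensional_def)

section \<open>Differentiation of Laplace transforms with nonnegative coefficients\<close>

locale laplace_integral =
  fixes M :: "'b measure" and I :: "'a set" and c :: "'a \<Rightarrow> 'b \<Rightarrow> real"
  assumes finite_I: "finite I"
    and c_measurable [measurable]: "\<And>i. i \<in> I \<Longrightarrow> c i \<in> borel_measurable M"
    and c_nonneg: "\<And>i \<omega>. i \<in> I \<Longrightarrow> 0 \<le> c i \<omega>"
begin

definition phase :: "('a \<Rightarrow> real) \<Rightarrow> 'b \<Rightarrow> real" where
  "phase x \<omega> = (\<Sum>i\<in>I. x i * c i \<omega>)"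

definition transform :: "('b \<Rightarrow> real) \<Rightarrow> ('a \<Rightarrow> real) \<Rightarrow> real" where
  "transform h x = (\<integral>\<omega>. h \<omega> * exp (- phase x \<omega>) \<partial>M)"

text \<open>Weights with a finite transform on the whole orthant. This class is closed under
  multiplication by each \<open>c j\<close>, so differentiation never leaves it.\<close>

definition admissible :: "('b \<Rightarrow> real) \<Rightarrow> bool" where
  "admissible h \<longleftrightarrow> h \<in> borel_measurable M \<and> (\<forall>\<omega>. 0 \<le> h \<omega>) \<and>
     (\<forall>x \<in> pos_orthant I. integrable M (\<lambda>\<omega>. h \<omega> * exp (- phase x \<omega>)))"

lemma phase_measurable [measurable]: "phase x \<in> borel_measurable M"
  unfolding phase_def by measurable

lemma phase_mono: "(\<And>i. i \<in> I \<Longrightarrow> x i \<le> y i) \<Longrightarrow> phase x \<omega> \<le> phase y \<omega>"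
  unfolding phase_def by (intro sum_mono mult_right_mono c_nonneg)

lemma phase_upd: "j \<in> I \<Longrightarrow> phase (x(j := t)) \<omega> = phase x \<omega> + (t - x j) * c j \<omega>"
proof -
  assume j: "j \<in> I"
  have "phase (x(j := t)) \<omega> = (\<Sum>i\<in>I. x i * c i \<omega> + (if i = j then (t - x j) * c j \<omega> else 0))"
    unfolding phase_def by (intro sum.cong) (auto simp: algebra_simps)
  then show ?thesis using j finite_I by (simp add: phase_def sum.distrib)
qed

lemma transform_nonneg: "admissible h \<Longrightarrow> 0 \<le> transform h x"
  unfolding transform_def admissible_def by (intro integral_nonneg_AE) auto

lemma admissible_integrable:
  "admissible h \<Longrightarrow> x \<in> pos_orthant I \<Longrightarrow> integrable M (\<lambda>\<omega>. h \<omega> * exp (- phase x \<omega>))"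
  by (simp add: admissible_def)

text \<open>The factor \<open>c j\<close> is absorbed by part of the exponential:
  \<open>d * c j \<omega> \<le> exp (d * c j \<omega>)\<close> with \<open>d = x j / 2\<close>. The
  price is to halve the coordinate \<open>x j\<close>, and the halved point still lies in the open
  orthant.\<close>

lemma admissible_times_c:
  assumes h: "admissible h" and j: "j \<in> I"
  shows "admissible (\<lambda>\<omega>. h \<omega> * c j \<omega>)"
  unfolding admissible_def
proof (intro conjI ballI allI)
  have [measurable]: "h \<in> borel_measurable M" and h0: "\<And>\<omega>. 0 \<le> h \<omega>"
    using h by (auto simp: admissible_def)
  show "(\<lambda>\<omega>. h \<omega> * c j \<omega>) \<in> borel_measurable M" using j by measurable
  show "0 \<le> h \<omega> * c j \<omega>" for \<omega> using h0 c_nonneg[OF j] by simp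
  fix x assume x: "x \<in> pos_orthant I"
  define d where "d = x j / 2"
  have d: "0 < d" using pos_orthantD[OF x j] by (simp add: d_def)
  define y where "y = x(j := d)"
  have y: "y \<in> pos_orthant I" unfolding y_def using x j d by (rule pos_orthant_upd)
  have "integrable M (\<lambda>\<omega>. (1 / d) * (h \<omega> * exp (- phase y \<omega>)))"
    using admissible_integrable[OF h y] by simp
  then show "integrable M (\<lambda>\<omega>. h \<omega> * c j \<omega> * exp (- phase x \<omega>))"
  proof (rule Bochner_Integration.integrable_bound)
    show "(\<lambda>\<omega>. h \<omega> * c j \<omega> * exp (- phase x \<omega>)) \<in> borel_measurable M" using j by measurable
    show "AE \<omega> in M. norm (h \<omega> * c j \<omega> * exp (- phase x \<omega>))
        \<le> norm (1 / d * (h \<omega> * exp (- phase y \<omega>)))"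
    proof (rule AE_I2)
      fix \<omega>
      have "d * c j \<omega> \<le> exp (d * c j \<omega>)" using exp_ge_add_one_self[of "d * c j \<omega>"] by linarith
      then have *: "c j \<omega> \<le> 1 / d * exp (d * c j \<omega>)" using d by (simp add: field_simps)
      have "phase y \<omega> = phase x \<omega> - d * c j \<omega>"
        unfolding y_def phase_upd[OF j] by (simp add: d_def algebra_simps)
      then have e: "exp (- phase y \<omega>) = exp (d * c j \<omega>) * exp (- phase x \<omega>)"
        by (simp add: exp_add[symmetric])
      have "h \<omega> * c j \<omega> * exp (- phase x \<omega>)
          \<le> h \<omega> * (1 / d * exp (d * c j \<omega>)) * exp (- phase x \<omega>)"
        using h0[of \<omega>] * by (intro mult_right_mono mult_left_mono) auto
      then show "norm (h \<omega> * c j \<omega> * exp (- phase x \<omega>))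
          \<le> norm (1 / d * (h \<omega> * exp (- phase y \<omega>)))"
        unfolding e using h0[of \<omega>] c_nonneg[OF j, of \<omega>] d by (simp add: abs_mult mult_ac)
    qed
  qed
qed

text \<open>
  The remainder is bounded by a transform at the point with \<open>x j\<close> halved, so monotonicity of the
  integral replaces dominated convergence.
\<close>

lemma transform_deriv:
  assumes h: "admissible h" and j: "j \<in> I" and x: "x \<in> pos_orthant I"
  shows "((\<lambda>t. transform h (x(j := t))) has_real_derivative
           - transform (\<lambda>\<omega>. h \<omega> * c j \<omega>) x) (at (x j))"
proof -
  define d where "d = x j / 2"
  have d: "0 < d" using pos_orthantD[OF x j] by (simp add: d_def)
  define y where "y = x(j := d)"
  have y: "y \<in> pos_orthant I" unfolding y_def using x j d by (rule pos_orthant_upd)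
  have h0: "\<And>\<omega>. 0 \<le> h \<omega>" using h by (auto simp: admissible_def)
  note h1 = admissible_times_c[OF h j]
  note h2 = admissible_times_c[OF h1 j]
  define D where "D = - transform (\<lambda>\<omega>. h \<omega> * c j \<omega>) x"
  define C where "C = transform (\<lambda>\<omega>. h \<omega> * c j \<omega> * c j \<omega>) y"
  \<comment> \<open>For \<open>d < t\<close> both \<open>x(j := t)\<close> and \<open>x\<close>
    dominate \<open>y\<close> coordinatewise, so \<open>phase y\<close> is a lower bound for both
    phases. The constant \<open>C\<close> therefore does not depend on \<open>t\<close>.\<close>
  have bound: "\<bar>transform h (x(j := t)) - transform h x - (t - x j) * D\<bar> \<le> (t - x j)\<^sup>2 * C"
    if t: "d < t" for t
  proof -
    have xt: "x(j := t) \<in> pos_orthant I" using pos_orthant_upd[OF x j] t d by auto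
    note i1 = admissible_integrable[OF h xt] and i2 = admissible_integrable[OF h x]
      and i3 = admissible_integrable[OF h1 x] and i4 = admissible_integrable[OF h2 y]
    have eq: "transform h (x(j := t)) - transform h x - (t - x j) * D =
       (\<integral>\<omega>. h \<omega> * exp (- phase (x(j := t)) \<omega>) - h \<omega> * exp (- phase x \<omega>)
          + (t - x j) * (h \<omega> * c j \<omega> * exp (- phase x \<omega>)) \<partial>M)"
      unfolding transform_def D_def using i1 i2 i3 by simp
    have "\<bar>h \<omega> * exp (- phase (x(j := t)) \<omega>) - h \<omega> * exp (- phase x \<omega>)
          + (t - x j) * (h \<omega> * c j \<omega> * exp (- phase x \<omega>))\<bar>
        \<le> (t - x j)\<^sup>2 * (h \<omega> * c j \<omega> * c j \<omega> * exp (- phase y \<omega>))" for \<omega>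
    proof -
      have "\<bar>exp (- phase (x(j := t)) \<omega>) - exp (- phase x \<omega>)
            + (phase (x(j := t)) \<omega> - phase x \<omega>) * exp (- phase x \<omega>)\<bar>
          \<le> (phase (x(j := t)) \<omega> - phase x \<omega>)\<^sup>2 * exp (- phase y \<omega>)"
        using t d by (intro exp_minus_taylor_bound phase_mono) (auto simp: y_def d_def)
      then have "h \<omega> * \<bar>exp (- phase (x(j := t)) \<omega>) - exp (- phase x \<omega>)
            + (phase (x(j := t)) \<omega> - phase x \<omega>) * exp (- phase x \<omega>)\<bar>
          \<le> h \<omega> * ((phase (x(j := t)) \<omega> - phase x \<omega>)\<^sup>2 * exp (- phase y \<omega>))"
        using h0 by (rule mult_left_mono)
      moreover have "h \<omega> * exp (- phase (x(j := t)) \<omega>) - h \<omega> * exp (- phase x \<omega>)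
          + (t - x j) * (h \<omega> * c j \<omega> * exp (- phase x \<omega>))
        = h \<omega> * (exp (- phase (x(j := t)) \<omega>) - exp (- phase x \<omega>)
            + (phase (x(j := t)) \<omega> - phase x \<omega>) * exp (- phase x \<omega>))"
        unfolding phase_upd[OF j] by (simp add: algebra_simps)
      moreover have "h \<omega> * ((phase (x(j := t)) \<omega> - phase x \<omega>)\<^sup>2 * exp (- phase y \<omega>)) =
          (t - x j)\<^sup>2 * (h \<omega> * c j \<omega> * c j \<omega> * exp (- phase y \<omega>))"
        unfolding phase_upd[OF j] by (simp add: power2_eq_square mult_ac)
      ultimately show ?thesis using h0[of \<omega>] by (simp only: abs_mult abs_of_nonneg)
    qed
    then have "\<bar>transform h (x(j := t)) - transform h x - (t - x j) * D\<bar>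
        \<le> (\<integral>\<omega>. (t - x j)\<^sup>2 * (h \<omega> * c j \<omega> * c j \<omega> * exp (- phase y \<omega>)) \<partial>M)"
      unfolding eq using i1 i2 i3 i4 by (intro abs_integral_le) auto
    then show ?thesis by (simp add: C_def transform_def)
  qed
  have "((\<lambda>t. (transform h (x(j := t)) - transform h x) / (t - x j) - D) \<longlongrightarrow> 0) (at (x j))"
  proof (rule Lim_null_comparison)
    have "\<forall>\<^sub>F t in at (x j). d < t"
      using d by (intro order_tendstoD(1)[OF tendsto_ident_at]) (auto simp: d_def)
    moreover have "\<forall>\<^sub>F t in at (x j). t \<noteq> x j" by (simp add: eventually_at_filter)
    ultimately show "\<forall>\<^sub>F t in at (x j).
        norm ((transform h (x(j := t)) - transform h x) / (t - x j) - D) \<le> \<bar>t - x j\<bar> * C"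
    proof eventually_elim
      case (elim t)
      have "(transform h (x(j := t)) - transform h x) / (t - x j) - D
          = (transform h (x(j := t)) - transform h x - (t - x j) * D) / (t - x j)"
        using elim by (simp add: field_simps)
      then have "norm ((transform h (x(j := t)) - transform h x) / (t - x j) - D)
          = \<bar>transform h (x(j := t)) - transform h x - (t - x j) * D\<bar> / \<bar>t - x j\<bar>"
        by (simp add: abs_divide)
      also have "\<dots> \<le> (t - x j)\<^sup>2 * C / \<bar>t - x j\<bar>"
        using bound[OF elim(1)] by (intro divide_right_mono) auto
      also have "\<dots> = \<bar>t - x j\<bar> * C"
        using elim(2) by (simp add: field_simps power2_eq_square abs_mult_self_eq)
      finally show ?case .
    qed
    have "((\<lambda>t. \<bar>t - x j\<bar> * C) \<longlongrightarrow> \<bar>x j - x j\<bar> * C) (at (x j))"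
      by (intro tendsto_intros)
    then show "((\<lambda>t. \<bar>t - x j\<bar> * C) \<longlongrightarrow> 0) (at (x j))" by simp
  qed
  then have "((\<lambda>t. (transform h (x(j := t)) - transform h x) / (t - x j)) \<longlongrightarrow> D) (at (x j))"
    by (rule LIM_zero_cancel)
  then show ?thesis
    unfolding has_field_derivative_iff D_def by simp
qed

text \<open>Near \<open>x\<close> every coordinate exceeds half of its value at \<open>x\<close>.
  There the Lipschitz bound for the exponential controls the difference of transforms by
  \<open>\<bar>y i - x i\<bar>\<close> times a finite transform at the halved point
  \<open>m\<close>, summed over \<open>i\<close>. Coordinatewise convergence makes this bound
  vanish.\<close>

lemma transform_continuous:
  assumes h: "admissible h"
  shows "continuous_on (pos_orthant I) (transform h)"
  unfolding continuous_on_def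
proof
  fix x assume x: "x \<in> pos_orthant I"
  \<comment> \<open>Values outside \<open>I\<close> are kept, so that \<open>m\<close> remains
    extensional.\<close>
  define m where "m = (\<lambda>i. if i \<in> I then x i / 2 else x i)"
  have m: "m \<in> pos_orthant I"
    using x by (auto simp: m_def pos_orthant_def PiE_iff extensional_def)
  have h0: "\<And>\<omega>. 0 \<le> h \<omega>" using h by (auto simp: admissible_def)
  have coord: "((\<lambda>y. y i) \<longlongrightarrow> x i) (at x within pos_orthant I)" for i
    using continuous_on_product_coordinates[of i, THEN continuous_on_subset, of "pos_orthant I"] x
    unfolding continuous_on_def by auto
  define B where "B = (\<lambda>y. \<Sum>i\<in>I. \<bar>y i - x i\<bar> * transform (\<lambda>\<omega>. h \<omega> * c i \<omega>) m)"
  have "((\<lambda>y. transform h y - transform h x) \<longlongrightarrow> 0) (at x within pos_orthant I)"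
  proof (rule Lim_null_comparison)
    have "\<forall>\<^sub>F y in at x within pos_orthant I. \<forall>i\<in>I. m i < y i"
      unfolding eventually_ball_finite_distrib[OF finite_I]
    proof
      fix i assume i: "i \<in> I"
      show "\<forall>\<^sub>F y in at x within pos_orthant I. m i < y i"
        using pos_orthantD[OF x i] i by (intro order_tendstoD(1)[OF coord]) (simp add: m_def)
    qed
    moreover have "\<forall>\<^sub>F y in at x within pos_orthant I. y \<in> pos_orthant I"
      by (simp add: eventually_at_filter)
    ultimately show "\<forall>\<^sub>F y in at x within pos_orthant I.
        norm (transform h y - transform h x) \<le> B y"
    proof eventually_elim
      case (elim y)
      have i1: "integrable M (\<lambda>\<omega>. \<Sum>i\<in>I. \<bar>y i - x i\<bar> * (h \<omega> * c i \<omega> * exp (- phase m \<omega>)))"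
        using admissible_integrable[OF admissible_times_c[OF h] m] by auto
      have B: "B y = (\<integral>\<omega>. (\<Sum>i\<in>I. \<bar>y i - x i\<bar> * (h \<omega> * c i \<omega> * exp (- phase m \<omega>))) \<partial>M)"
        unfolding B_def transform_def
        using admissible_integrable[OF admissible_times_c[OF h] m] by simp
      have "\<bar>h \<omega> * exp (- phase y \<omega>) - h \<omega> * exp (- phase x \<omega>)\<bar>
          \<le> (\<Sum>i\<in>I. \<bar>y i - x i\<bar> * (h \<omega> * c i \<omega> * exp (- phase m \<omega>)))" for \<omega>
      proof -
        have "\<bar>phase y \<omega> - phase x \<omega>\<bar> = \<bar>\<Sum>i\<in>I. (y i - x i) * c i \<omega>\<bar>"
          by (simp add: phase_def sum_subtractf left_diff_distrib)
        also have "\<dots> \<le> (\<Sum>i\<in>I. \<bar>y i - x i\<bar> * c i \<omega>)"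
          using c_nonneg by (intro order.trans[OF sum_abs] sum_mono) (simp add: abs_mult)
        finally have ph: "\<bar>phase y \<omega> - phase x \<omega>\<bar> \<le> (\<Sum>i\<in>I. \<bar>y i - x i\<bar> * c i \<omega>)" .
        have "\<bar>exp (- phase y \<omega>) - exp (- phase x \<omega>)\<bar>
            \<le> \<bar>phase y \<omega> - phase x \<omega>\<bar> * exp (- phase m \<omega>)"
        proof (intro exp_minus_lipschitz_bound phase_mono)
          show "m i \<le> y i" "m i \<le> x i" if "i \<in> I" for i
            using elim(1) that pos_orthantD[OF x that] by (auto simp: m_def intro: less_imp_le)
        qed
        also have "\<dots> \<le> (\<Sum>i\<in>I. \<bar>y i - x i\<bar> * c i \<omega>) * exp (- phase m \<omega>)"
          using ph by (intro mult_right_mono) auto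
        finally have "h \<omega> * \<bar>exp (- phase y \<omega>) - exp (- phase x \<omega>)\<bar>
            \<le> h \<omega> * ((\<Sum>i\<in>I. \<bar>y i - x i\<bar> * c i \<omega>) * exp (- phase m \<omega>))"
          using h0 by (rule mult_left_mono)
        also have "h \<omega> * ((\<Sum>i\<in>I. \<bar>y i - x i\<bar> * c i \<omega>) * exp (- phase m \<omega>))
            = (\<Sum>i\<in>I. \<bar>y i - x i\<bar> * (h \<omega> * c i \<omega> * exp (- phase m \<omega>)))"
          by (simp add: sum_distrib_left sum_distrib_right mult_ac)
        finally show ?thesis
          using h0[of \<omega>] by (simp add: right_diff_distrib[symmetric] abs_mult)
      qed
      then have "\<bar>\<integral>\<omega>. h \<omega> * exp (- phase y \<omega>) - h \<omega> * exp (- phase x \<omega>) \<partial>M\<bar> \<le> B y"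
        unfolding B using i1 admissible_integrable[OF h x] admissible_integrable[OF h elim(2)]
        by (intro abs_integral_le) auto
      then show ?case
        unfolding transform_def
        using admissible_integrable[OF h x] admissible_integrable[OF h elim(2)] by simp
    qed
    have "(B \<longlongrightarrow> (\<Sum>i\<in>I. \<bar>x i - x i\<bar> * transform (\<lambda>\<omega>. h \<omega> * c i \<omega>) m))
        (at x within pos_orthant I)"
      unfolding B_def by (intro tendsto_intros coord)
    then show "(B \<longlongrightarrow> 0) (at x within pos_orthant I)" by simp
  qed
  then show "(transform h \<longlongrightarrow> transform h x) (at x within pos_orthant I)"
    by (rule LIM_zero_cancel)
qed

lemma admissible_prod_list:
  assumes "admissible (\<lambda>_. 1)" "js \<in> lists I"
  shows "admissible (\<lambda>\<omega>. \<Prod>j\<leftarrow>js. c j \<omega>)"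
  using assms(2)
proof (induction js)
  case Nil
  then show ?case using assms(1) by simp
next
  case (Cons j js)
  then have "admissible (\<lambda>\<omega>. (\<Prod>j\<leftarrow>js. c j \<omega>) * c j \<omega>)" by (intro admissible_times_c) auto
  then show ?case by (simp add: mult.commute)
qed

text \<open>Derivatives depend only on germs. Since the orthant is open in each coordinate, formulas
  known only on the orthant may be differentiated there.\<close>

lemma orthant_slice_cong_ev:
  assumes "\<And>y. y \<in> pos_orthant I \<Longrightarrow> f y = g y" "x \<in> pos_orthant I" "j \<in> I"
  shows "\<forall>\<^sub>F t in nhds (x j). f (x(j := t)) = g (x(j := t))"
proof -
  have "\<forall>\<^sub>F t in nhds (x j). 0 < t"
    using pos_orthantD[OF assms(2,3)] by (intro order_tendstoD(1)[OF filterlim_ident])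
  then show ?thesis
    by eventually_elim (rule assms(1)[OF pos_orthant_upd[OF assms(2,3)]])
qed

text \<open>Each partial derivative brings down a factor \<open>- c j\<close>. An iterated one is
  thus \<open>(- 1) ^ length js\<close> times the transform of a product of nonnegative
  functions.\<close>

theorem completely_monotone_transform:
  assumes adm: "admissible (\<lambda>_. 1)"
    and f: "\<And>x. x \<in> pos_orthant I \<Longrightarrow> f x = transform (\<lambda>_. 1) x"
  shows "completely_monotone I f"
proof -
  define F where "F js x = (- 1) ^ length js * transform (\<lambda>\<omega>. \<Prod>j\<leftarrow>js. c j \<omega>) x" for js x
  have dF: "((\<lambda>t. F js (x(j := t))) has_real_derivative F (j # js) x) (at (x j))"
    if "js \<in> lists I" "j \<in> I" "x \<in> pos_orthant I" for js j x
    using DERIV_cmult[OF transform_deriv[OF admissible_prod_list[OF adm that(1)] that(2,3)],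
        of "(- 1) ^ length js"]
    unfolding F_def by (simp add: mult.commute)
  have iter: "iter_partial js f x = F js x" if "js \<in> lists I" "x \<in> pos_orthant I" for js x
    using that
  proof (induction js arbitrary: x rule: list.induct)
    case Nil
    then show ?case by (simp add: iter_partial_def F_def f)
  next
    case (Cons j js)
    then have j: "j \<in> I" and js: "js \<in> lists I" by auto
    \<comment> \<open>\<open>foldr\<close> applies the head of the list last, so the formula for the
      tail is the function to differentiate.\<close>
    have "iter_partial (j # js) f x = deriv (\<lambda>t. iter_partial js f (x(j := t))) (x j)"
      by (simp add: iter_partial_def partial_deriv_def)
    also have "\<dots> = deriv (\<lambda>t. F js (x(j := t))) (x j)"
      by (intro deriv_cong_ev orthant_slice_cong_ev[OF Cons.IH[OF js]] Cons.prems(2) j refl)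
    also have "\<dots> = F (j # js) x"
      by (intro DERIV_imp_deriv dF js j Cons.prems(2))
    finally show ?case .
  qed
  show ?thesis
    unfolding completely_monotone_def smooth_on_orthant_def
  proof (intro conjI ballI allI impI)
    fix js assume js: "js \<in> lists I"
    have "continuous_on (pos_orthant I) (F js)"
      unfolding F_def
      by (intro continuous_intros transform_continuous admissible_prod_list[OF adm js])
    then show "continuous_on (pos_orthant I) (iter_partial js f)"
      using iter[OF js] by (simp cong: continuous_on_cong)
    fix i x assume i: "i \<in> I" and x: "x \<in> pos_orthant I"
    have "((\<lambda>t. iter_partial js f (x(i := t))) has_real_derivative F (i # js) x) (at (x i))"
      by (subst DERIV_cong_ev[OF refl orthant_slice_cong_ev[OF _ x i, where g = "F js"] refl])
         (use iter[OF js] dF[OF js i x] in auto)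
    then show "(\<lambda>t. iter_partial js f (x(i := t))) field_differentiable at (x i)"
      unfolding field_differentiable_def by (rule exI)
  next
    fix \<alpha> :: "'a \<Rightarrow> nat" and js x
    assume js: "js \<in> lists I" and \<alpha>: "\<forall>i\<in>I. count_list js i = \<alpha> i" and x: "x \<in> pos_orthant I"
    \<comment> \<open>The order of the multi-index is the length of the list, so the two signs
      cancel.\<close>
    have "(\<Sum>i\<in>I. \<alpha> i) = (\<Sum>i\<in>I. count_list js i)"
      using \<alpha> by (intro sum.cong) auto
    also have "\<dots> = length js"
      using js finite_I by (intro sum_count_set) auto
    finally have "(- 1) ^ (\<Sum>i\<in>I. \<alpha> i) * iter_partial js f x =
        transform (\<lambda>\<omega>. \<Prod>j\<leftarrow>js. c j \<omega>) x"
      using iter[OF js x] by (simp add: F_def)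
    then show "0 \<le> (- 1) ^ (\<Sum>i\<in>I. \<alpha> i) * iter_partial js f x"
      using transform_nonneg[OF admissible_prod_list[OF adm js]] by simp
  qed
qed

end

section \<open>Gamma, Gaussian and Wishart integrals\<close>

text \<open>The Gamma density without its exponential factor; for \<open>\<gamma> > 0\<close> its
  Laplace transform at \<open>a > 0\<close> is \<open>a powr - \<gamma>\<close>.\<close>

definition gamma_weight :: "real \<Rightarrow> real measure" where
  "gamma_weight \<gamma> = density lborel (\<lambda>t. ennreal (indicator {0..} t * t powr (\<gamma> - 1) / Gamma \<gamma>))"

text \<open>Lebesgue measure, scaled so that \<open>exp (- w\<^sup>2)\<close> has integral
  1.\<close>

definition gauss_weight :: "real measure" where
  "gauss_weight = density lborel (\<lambda>_. ennreal (1 / sqrt pi))"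

lemma sets_gamma_weight [measurable_cong, simp]: "sets (gamma_weight \<gamma>) = sets borel"
  by (simp add: gamma_weight_def)

lemma sets_gauss_weight [measurable_cong, simp]: "sets gauss_weight = sets borel"
  by (simp add: gauss_weight_def)

lemma sigma_finite_gamma_weight: "sigma_finite_measure (gamma_weight \<gamma>)"
  unfolding gamma_weight_def
  by (subst sigma_finite_measure.sigma_finite_iff_density_finite[OF sigma_finite_lborel]) auto

lemma sigma_finite_gauss_weight: "sigma_finite_measure gauss_weight"
  unfolding gauss_weight_def
  by (subst sigma_finite_measure.sigma_finite_iff_density_finite[OF sigma_finite_lborel]) auto

text \<open>Replacing \<open>t\<close> by \<open>t / a\<close> reduces the claim to Euler's integral
  for \<open>Gamma \<gamma>\<close>.\<close>

lemma nn_integral_gamma_weight: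
  assumes \<gamma>: "0 < \<gamma>" and a: "0 < a"
  shows "(\<integral>\<^sup>+t. ennreal (exp (- (a * \<bar>t\<bar>))) \<partial>gamma_weight \<gamma>) = ennreal (a powr - \<gamma>)"
proof -
  have G: "0 < Gamma \<gamma>" using \<gamma> by simp
  have "(\<integral>\<^sup>+t. ennreal (exp (- (a * \<bar>t\<bar>))) \<partial>gamma_weight \<gamma>) =
      (\<integral>\<^sup>+t. ennreal (indicator {0..} t * t powr (\<gamma> - 1) / Gamma \<gamma>) * ennreal (exp (- (a * \<bar>t\<bar>))) \<partial>lborel)"
    unfolding gamma_weight_def by (subst nn_integral_density) auto
  also have "\<dots> = (\<integral>\<^sup>+t. ennreal (indicator {0..} t * t powr (\<gamma> - 1) / Gamma \<gamma> * exp (- (a * \<bar>t\<bar>))) \<partial>lborel)"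
    using G by (intro nn_integral_cong ennreal_mult'[symmetric]) auto
  also have "\<dots> = ennreal \<bar>1 / a\<bar> * (\<integral>\<^sup>+t. ennreal (indicator {0..} (0 + 1 / a * t) * (0 + 1 / a * t) powr (\<gamma> - 1)
      / Gamma \<gamma> * exp (- (a * \<bar>0 + 1 / a * t\<bar>))) \<partial>lborel)"
    using a by (intro nn_integral_real_affine) auto
  also have "\<dots> = ennreal (1 / a) * (\<integral>\<^sup>+t. ennreal (a powr (1 - \<gamma>) / Gamma \<gamma>) *
      ennreal (indicator {0..} t * t powr (\<gamma> - 1) / exp t) \<partial>lborel)"
  proof (intro arg_cong2[of _ _ _ _ "(*)"] nn_integral_cong)
    fix t :: real
    have "indicator {0..} (0 + 1 / a * t) * (0 + 1 / a * t) powr (\<gamma> - 1) / Gamma \<gamma> * exp (- (a * \<bar>0 + 1 / a * t\<bar>))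
       = a powr (1 - \<gamma>) / Gamma \<gamma> * (indicator {0..} t * t powr (\<gamma> - 1) / exp t)"
    proof (cases "0 \<le> t")
      case True
      have "(t / a) powr (\<gamma> - 1) = a powr (1 - \<gamma>) * t powr (\<gamma> - 1)"
        using a True powr_minus_divide[of a "\<gamma> - 1"] by (simp add: powr_divide)
      then show ?thesis using True a by (simp add: exp_minus field_simps)
    next
      case False
      then show ?thesis using a by (simp add: zero_le_divide_iff)
    qed
    then show "ennreal (indicator {0..} (0 + 1 / a * t) * (0 + 1 / a * t) powr (\<gamma> - 1) / Gamma \<gamma> * exp (- (a * \<bar>0 + 1 / a * t\<bar>)))
       = ennreal (a powr (1 - \<gamma>) / Gamma \<gamma>) * ennreal (indicator {0..} t * t powr (\<gamma> - 1) / exp t)"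
      using G by (simp flip: ennreal_mult')
  qed (use a in simp)
  also have "\<dots> = ennreal (1 / a) * (ennreal (a powr (1 - \<gamma>) / Gamma \<gamma>) * ennreal (Gamma \<gamma>))"
    unfolding Gamma_conv_nn_integral_real[OF \<gamma>] by (subst nn_integral_cmult) auto
  also have "\<dots> = ennreal (1 / a * (a powr (1 - \<gamma>) / Gamma \<gamma> * Gamma \<gamma>))"
    using a G by (simp flip: ennreal_mult')
  also have "1 / a * (a powr (1 - \<gamma>) / Gamma \<gamma> * Gamma \<gamma>) = a powr - \<gamma>"
    using a G by (simp add: powr_diff powr_minus_divide)
  finally show ?thesis .
qed

text \<open>Completing the square turns the integrand into a multiple of the normal density with
  mean \<open>- z / a\<close> and variance \<open>1 / (2 * a)\<close>. Read from right to left, it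
  trades the quotient \<open>z\<^sup>2 / a\<close> for an exponent linear in \<open>a\<close> and in
  \<open>z\<close>.\<close>

lemma nn_integral_gauss_weight:
  assumes a: "0 < a"
  shows "(\<integral>\<^sup>+w. ennreal (exp (- (a * w\<^sup>2 + 2 * w * z))) \<partial>gauss_weight) =
    ennreal (a powr - (1 / 2) * exp (z\<^sup>2 / a))"
proof -
  define \<sigma> where "\<sigma> = 1 / sqrt (2 * a)"
  have \<sigma>: "0 < \<sigma>" "\<sigma>\<^sup>2 = 1 / (2 * a)" using a by (auto simp: \<sigma>_def power_divide)
  have "(\<integral>\<^sup>+w. ennreal (exp (- (a * w\<^sup>2 + 2 * w * z))) \<partial>gauss_weight) =
      (\<integral>\<^sup>+w. ennreal (1 / sqrt pi) * ennreal (exp (- (a * w\<^sup>2 + 2 * w * z))) \<partial>lborel)"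
    unfolding gauss_weight_def by (subst nn_integral_density) auto
  also have "\<dots> = (\<integral>\<^sup>+w. ennreal (a powr - (1 / 2) * exp (z\<^sup>2 / a)) *
      ennreal (normal_density (- z / a) \<sigma> w) \<partial>lborel)"
  proof (intro nn_integral_cong)
    fix w :: real
    have "(w - - z / a)\<^sup>2 / (2 * \<sigma>\<^sup>2) = a * w\<^sup>2 + 2 * w * z + z\<^sup>2 / a"
      unfolding \<sigma>(2) using a by (simp add: power2_eq_square field_simps)
    then have e: "exp (- (w - - z / a)\<^sup>2 / (2 * \<sigma>\<^sup>2)) = exp (- (a * w\<^sup>2 + 2 * w * z)) * exp (- (z\<^sup>2 / a))"
      by (simp add: exp_add[symmetric])
    have s: "sqrt (2 * pi * \<sigma>\<^sup>2) = sqrt pi / sqrt a" using a by (simp add: \<sigma>(2) real_sqrt_divide)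
    have "1 / sqrt pi * exp (- (a * w\<^sup>2 + 2 * w * z)) =
       a powr - (1 / 2) * exp (z\<^sup>2 / a) * normal_density (- z / a) \<sigma> w"
      unfolding normal_density_def e s using a
      by (simp add: powr_minus powr_half_sqrt exp_minus field_simps)
    then show "ennreal (1 / sqrt pi) * ennreal (exp (- (a * w\<^sup>2 + 2 * w * z))) =
       ennreal (a powr - (1 / 2) * exp (z\<^sup>2 / a)) * ennreal (normal_density (- z / a) \<sigma> w)"
      using a by (simp flip: ennreal_mult')
  qed
  also have "\<dots> = ennreal (a powr - (1 / 2) * exp (z\<^sup>2 / a)) *
      (\<integral>\<^sup>+w. ennreal (normal_density (- z / a) \<sigma> w) \<partial>lborel)"
    by (intro nn_integral_cmult) auto
  also have "(\<integral>\<^sup>+w. ennreal (normal_density (- z / a) \<sigma> w) \<partial>lborel) = 1"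
    using \<sigma>(1) by (subst nn_integral_eq_integral) auto
  finally show ?thesis by simp
qed

section \<open>Products of the weights and their integrals\<close>

lemma nn_integral_triple:
  assumes M: "sigma_finite_measure M" and N: "sigma_finite_measure N"
    and f: "f \<in> borel_measurable (L \<Otimes>\<^sub>M M \<Otimes>\<^sub>M N)"
  shows "integral\<^sup>N (L \<Otimes>\<^sub>M M \<Otimes>\<^sub>M N) f = (\<integral>\<^sup>+x. \<integral>\<^sup>+y. \<integral>\<^sup>+z. f (x, y, z) \<partial>N \<partial>M \<partial>L)"
proof -
  interpret N: sigma_finite_measure N by (rule N)
  interpret MN: sigma_finite_measure "M \<Otimes>\<^sub>M N" by (intro sigma_finite_pair_measure M N)
  have "integral\<^sup>N (L \<Otimes>\<^sub>M M \<Otimes>\<^sub>M N) f = (\<integral>\<^sup>+x. \<integral>\<^sup>+yz. f (x, yz) \<partial>(M \<Otimes>\<^sub>M N) \<partial>L)"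
    by (rule MN.nn_integral_fst[symmetric, OF f])
  also have "\<dots> = (\<integral>\<^sup>+x. \<integral>\<^sup>+y. \<integral>\<^sup>+z. f (x, y, z) \<partial>N \<partial>M \<partial>L)"
    by (intro nn_integral_cong N.nn_integral_fst[symmetric] measurable_Pair2[OF f])
  finally show ?thesis .
qed

text \<open>
  The Gamma weights live on \<open>[0,\<infinity>)\<close>.  Absolute values are put around their variables so that the
  coefficients of the edge variables are nonnegative everywhere and not only almost everywhere.
\<close>

definition schur_weight :: "real \<Rightarrow> (real \<times> real \<times> real) measure" where
  "schur_weight \<beta> = gamma_weight (\<beta> - 1) \<Otimes>\<^sub>M gauss_weight \<Otimes>\<^sub>M gauss_weight"

text \<open>
  A point \<open>(u, s, y)\<close> encodes the positive semidefinite matrix \<open>S\<close> with entries \<open>u + y\<^sup>2\<close>, \<open>y \<surd>s\<close>, \<open>s\<close>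
  through its Cholesky factor; the weight is that of the Wishart distribution in these coordinates.
\<close>

definition cholesky_weight :: "real \<Rightarrow> (real \<times> real \<times> real) measure" where
  "cholesky_weight \<beta> = gamma_weight (\<beta> - 1 / 2) \<Otimes>\<^sub>M gamma_weight \<beta> \<Otimes>\<^sub>M gauss_weight"

lemma sets_schur_weight [measurable_cong]: "sets (schur_weight \<beta>) = sets (borel \<Otimes>\<^sub>M borel \<Otimes>\<^sub>M borel)"
  unfolding schur_weight_def by (intro sets_pair_measure_cong) simp_all

lemma sets_cholesky_weight [measurable_cong]:
  "sets (cholesky_weight \<beta>) = sets (borel \<Otimes>\<^sub>M borel \<Otimes>\<^sub>M borel)"
  unfolding cholesky_weight_def by (intro sets_pair_measure_cong) simp_all

lemma sigma_finite_schur_weight: "sigma_finite_measure (schur_weight \<beta>)"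
  unfolding schur_weight_def
  by (intro sigma_finite_pair_measure sigma_finite_gamma_weight sigma_finite_gauss_weight)

text \<open>The exponent splits as \<open>\<beta> = (\<beta> - 1) + 1 / 2 + 1 / 2\<close>: the Gamma
  weight supplies the first part, which is positive as \<open>\<beta> > 1\<close>, and each Gaussian
  supplies one half together with its factor \<open>exp (z\<^sup>2 / a)\<close>.\<close>

lemma nn_integral_schur_weight:
  assumes \<beta>: "1 < \<beta>" and a: "0 < a"
  shows "(\<integral>\<^sup>+(t, w, w'). ennreal (exp (- (a * (\<bar>t\<bar> + w\<^sup>2 + w'\<^sup>2) + 2 * w * z + 2 * w' * z'))) \<partial>schur_weight \<beta>)
    = ennreal (a powr - \<beta> * exp ((z\<^sup>2 + z'\<^sup>2) / a))"
proof -
  let ?g = "\<lambda>w z. exp (- (a * w\<^sup>2 + 2 * w * z))"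
  let ?G = "\<lambda>z. a powr - (1 / 2) * exp (z\<^sup>2 / a)"
  have "(\<integral>\<^sup>+(t, w, w'). ennreal (exp (- (a * (\<bar>t\<bar> + w\<^sup>2 + w'\<^sup>2) + 2 * w * z + 2 * w' * z'))) \<partial>schur_weight \<beta>)
    = (\<integral>\<^sup>+t. \<integral>\<^sup>+w. \<integral>\<^sup>+w'. ennreal (exp (- (a * (\<bar>t\<bar> + w\<^sup>2 + w'\<^sup>2) + 2 * w * z + 2 * w' * z')))
        \<partial>gauss_weight \<partial>gauss_weight \<partial>gamma_weight (\<beta> - 1))"
    unfolding schur_weight_def
    by (subst nn_integral_triple)
       (simp_all add: sigma_finite_gauss_weight sigma_finite_gamma_weight)
  also have "\<dots> = (\<integral>\<^sup>+t. \<integral>\<^sup>+w. \<integral>\<^sup>+w'. ennreal (exp (- (a * \<bar>t\<bar>))) * (ennreal (?g w z) * ennreal (?g w' z'))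
        \<partial>gauss_weight \<partial>gauss_weight \<partial>gamma_weight (\<beta> - 1))"
    by (intro nn_integral_cong, simp flip: ennreal_mult' exp_add) (simp add: algebra_simps)
  also have "\<dots> = ennreal ((a powr - (\<beta> - 1))) * (ennreal (?G z) * ennreal (?G z'))"
    using \<beta> a
    by (simp add: nn_integral_cmult nn_integral_multc nn_integral_gauss_weight nn_integral_gamma_weight
        del: minus_add_distrib)
  also have "\<dots> = ennreal (a powr - (\<beta> - 1) * (?G z * ?G z'))"
    by (simp flip: ennreal_mult')
  also have "a powr - (\<beta> - 1) * (?G z * ?G z') = a powr - \<beta> * exp ((z\<^sup>2 + z'\<^sup>2) / a)"
  proof -
    have "a powr - (\<beta> - 1) * (?G z * ?G z') =
        (a powr - (\<beta> - 1) * (a powr - (1 / 2) * a powr - (1 / 2))) * (exp (z\<^sup>2 / a) * exp (z'\<^sup>2 / a))"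
      by (simp only: mult_ac)
    also have "a powr - (\<beta> - 1) * (a powr - (1 / 2) * a powr - (1 / 2)) = a powr - \<beta>"
      unfolding powr_add[symmetric] by simp
    also have "exp (z\<^sup>2 / a) * exp (z'\<^sup>2 / a) = exp ((z\<^sup>2 + z'\<^sup>2) / a)"
      by (simp add: add_divide_distrib flip: exp_add)
    finally show ?thesis .
  qed
  finally show ?thesis .
qed

text \<open>The exponent is minus the trace of \<open>S\<close> times the matrix with rows
  \<open>(p, q)\<close> and \<open>(q, r)\<close>. The Gaussian integral over \<open>y\<close>
  lowers the coefficient of \<open>\<bar>s\<bar>\<close> from \<open>r\<close> to
  \<open>r - q\<^sup>2 / p\<close>; the two Gamma integrals then give the powers of \<open>p\<close>
  and of this Schur complement, whose product is the determinant.\<close>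

lemma nn_integral_cholesky_weight:
  assumes \<beta>: "1 / 2 < \<beta>" and p: "0 < p" and d: "0 < p * r - q\<^sup>2"
  shows "(\<integral>\<^sup>+(u, s, y). ennreal (exp (- (p * (\<bar>u\<bar> + y\<^sup>2) + 2 * y * (sqrt \<bar>s\<bar> * q) + r * \<bar>s\<bar>))) \<partial>cholesky_weight \<beta>)
    = ennreal ((p * r - q\<^sup>2) powr - \<beta>)"
proof -
  define e where "e = r - q\<^sup>2 / p"
  have e: "0 < e" using p d by (simp add: e_def field_simps)
  have pe: "p * r - q\<^sup>2 = p * e" using p by (simp add: e_def field_simps)
  have "(\<integral>\<^sup>+(u, s, y). ennreal (exp (- (p * (\<bar>u\<bar> + y\<^sup>2) + 2 * y * (sqrt \<bar>s\<bar> * q) + r * \<bar>s\<bar>))) \<partial>cholesky_weight \<beta>)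
    = (\<integral>\<^sup>+u. \<integral>\<^sup>+s. \<integral>\<^sup>+y. ennreal (exp (- (p * (\<bar>u\<bar> + y\<^sup>2) + 2 * y * (sqrt \<bar>s\<bar> * q) + r * \<bar>s\<bar>)))
        \<partial>gauss_weight \<partial>gamma_weight \<beta> \<partial>gamma_weight (\<beta> - 1 / 2))"
    unfolding cholesky_weight_def
    by (subst nn_integral_triple)
       (simp_all add: sigma_finite_gauss_weight sigma_finite_gamma_weight)
  also have "\<dots> = (\<integral>\<^sup>+u. \<integral>\<^sup>+s. \<integral>\<^sup>+y. ennreal (exp (- (p * \<bar>u\<bar>))) * (ennreal (exp (- (r * \<bar>s\<bar>))) *
      ennreal (exp (- (p * y\<^sup>2 + 2 * y * (sqrt \<bar>s\<bar> * q)))))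
        \<partial>gauss_weight \<partial>gamma_weight \<beta> \<partial>gamma_weight (\<beta> - 1 / 2))"
    by (intro nn_integral_cong, simp flip: ennreal_mult' exp_add) (simp add: algebra_simps)
  also have "\<dots> = (\<integral>\<^sup>+u. \<integral>\<^sup>+s. ennreal (exp (- (p * \<bar>u\<bar>))) * (ennreal (exp (- (r * \<bar>s\<bar>))) *
      ennreal (p powr - (1 / 2) * exp ((sqrt \<bar>s\<bar> * q)\<^sup>2 / p))) \<partial>gamma_weight \<beta> \<partial>gamma_weight (\<beta> - 1 / 2))"
    using p by (simp add: nn_integral_cmult nn_integral_gauss_weight del: minus_add_distrib)
  also have "\<dots> = (\<integral>\<^sup>+u. \<integral>\<^sup>+s. ennreal (exp (- (p * \<bar>u\<bar>))) * (ennreal (p powr - (1 / 2)) *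
      ennreal (exp (- (e * \<bar>s\<bar>)))) \<partial>gamma_weight \<beta> \<partial>gamma_weight (\<beta> - 1 / 2))"
  proof -
    have "ennreal (exp (- (r * \<bar>s\<bar>))) * ennreal (p powr - (1 / 2) * exp ((sqrt \<bar>s\<bar> * q)\<^sup>2 / p)) =
        ennreal (p powr - (1 / 2)) * ennreal (exp (- (e * \<bar>s\<bar>)))" for s
    proof -
      have "exp (- (r * \<bar>s\<bar>)) * (p powr - (1 / 2) * exp ((sqrt \<bar>s\<bar> * q)\<^sup>2 / p)) =
          p powr - (1 / 2) * (exp (- (r * \<bar>s\<bar>)) * exp ((sqrt \<bar>s\<bar> * q)\<^sup>2 / p))"
        by (simp only: mult_ac)
      also have "exp (- (r * \<bar>s\<bar>)) * exp ((sqrt \<bar>s\<bar> * q)\<^sup>2 / p) = exp (- (e * \<bar>s\<bar>))"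
        by (simp add: e_def power_mult_distrib algebra_simps flip: exp_add)
      finally show ?thesis
        by (simp flip: ennreal_mult')
    qed
    then show ?thesis by simp
  qed
  also have "\<dots> = ennreal (p powr - (\<beta> - 1 / 2)) * (ennreal (p powr - (1 / 2)) * ennreal (e powr - \<beta>))"
    using p \<beta> e by (simp add: nn_integral_cmult nn_integral_multc nn_integral_gamma_weight)
  also have "\<dots> = ennreal ((p powr - (\<beta> - 1 / 2) * p powr - (1 / 2)) * e powr - \<beta>)"
    by (simp add: mult.assoc flip: ennreal_mult')
  also have "(p powr - (\<beta> - 1 / 2) * p powr - (1 / 2)) * e powr - \<beta> = (p * r - q\<^sup>2) powr - \<beta>"
    unfolding pe using p e by (simp add: powr_mult flip: powr_add)
  finally show ?thesis .
qed

text \<open>The first triple encodes \<open>S\<close> for the rim vertices 2 and 4; the other two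
  hold the auxiliary variables that eliminate the vertices 1 and 3.\<close>

definition cyclic_weight :: "real \<Rightarrow> ((real \<times> real \<times> real) \<times> (real \<times> real \<times> real) \<times> (real \<times> real \<times> real)) measure" where
  "cyclic_weight \<beta> = cholesky_weight \<beta> \<Otimes>\<^sub>M schur_weight \<beta> \<Otimes>\<^sub>M schur_weight \<beta>"

lemma sets_cyclic_weight [measurable_cong]:
  "sets (cyclic_weight \<beta>) = sets ((borel \<Otimes>\<^sub>M borel \<Otimes>\<^sub>M borel) \<Otimes>\<^sub>M
     (borel \<Otimes>\<^sub>M borel \<Otimes>\<^sub>M borel) \<Otimes>\<^sub>M (borel \<Otimes>\<^sub>M borel \<Otimes>\<^sub>M borel))"
  unfolding cyclic_weight_def
  by (intro sets_pair_measure_cong sets_schur_weight sets_cholesky_weight)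

text \<open>With \<open>z = sqrt \<bar>u\<bar> * b\<close> and
  \<open>z' = y * b + sqrt \<bar>s\<bar> * b'\<close>, the sum \<open>z\<^sup>2 + z'\<^sup>2\<close>
  is the quadratic form of \<open>S\<close> at \<open>(b, b')\<close>. Integrating out the two Schur
  blocks therefore subtracts the rank-one corrections with denominators \<open>a\<close> and
  \<open>c\<close>, and the Cholesky block then produces the determinant.\<close>

lemma nn_integral_cyclic_weight:
  fixes a b b' c d d' p r :: real
  defines "P \<equiv> p - b\<^sup>2 / a - d\<^sup>2 / c" and "R \<equiv> r - b'\<^sup>2 / a - d'\<^sup>2 / c"
    and "Q \<equiv> - (b * b' / a + d * d' / c)"
  assumes \<beta>: "1 < \<beta>" and a: "0 < a" and c: "0 < c" and P: "0 < P" and D: "0 < P * R - Q\<^sup>2"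
  shows "(\<integral>\<^sup>+((u, s, y), (t, w, w'), (k, m, m')).
      ennreal (exp (- (p * (\<bar>u\<bar> + y\<^sup>2) + r * \<bar>s\<bar>
        + (a * (\<bar>t\<bar> + w\<^sup>2 + w'\<^sup>2) + 2 * w * (sqrt \<bar>u\<bar> * b) + 2 * w' * (y * b + sqrt \<bar>s\<bar> * b'))
        + (c * (\<bar>k\<bar> + m\<^sup>2 + m'\<^sup>2) + 2 * m * (sqrt \<bar>u\<bar> * d) + 2 * m' * (y * d + sqrt \<bar>s\<bar> * d')))))
      \<partial>cyclic_weight \<beta>)
    = ennreal ((a * c * (P * R - Q\<^sup>2)) powr - \<beta>)"
proof -
  define E0 where "E0 = (\<lambda>(u, s, y). p * (\<bar>u\<bar> + y\<^sup>2) + r * \<bar>s\<bar>)"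
  define S where "S a b b' = (\<lambda>((u, s, y), (t, w, w')). a * (\<bar>t\<bar> + w\<^sup>2 + w'\<^sup>2)
      + 2 * w * (sqrt \<bar>u\<bar> * b) + 2 * w' * (y * b + sqrt \<bar>s\<bar> * b'))" for a b b' :: real
  have [measurable]: "E0 \<in> borel_measurable (borel \<Otimes>\<^sub>M borel \<Otimes>\<^sub>M borel)"
    unfolding E0_def by measurable
  have [measurable]: "S a b b' \<in> borel_measurable ((borel \<Otimes>\<^sub>M borel \<Otimes>\<^sub>M borel) \<Otimes>\<^sub>M
     (borel \<Otimes>\<^sub>M borel \<Otimes>\<^sub>M borel))" for a b b'
    unfolding S_def case_prod_unfold by measurable
  have [measurable]: "(\<lambda>h. S a b b' (f, h)) \<in> borel_measurable (borel \<Otimes>\<^sub>M borel \<Otimes>\<^sub>M borel)" for a b b' f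
    unfolding S_def case_prod_unfold fst_conv snd_conv by measurable
  have int_S: "(\<integral>\<^sup>+h. ennreal (exp (- S a b b' ((u, s, y), h))) \<partial>schur_weight \<beta>) =
      ennreal (a powr - \<beta> * exp (((sqrt \<bar>u\<bar> * b)\<^sup>2 + (y * b + sqrt \<bar>s\<bar> * b')\<^sup>2) / a))"
    if "0 < a" for a b b' u s y
    using nn_integral_schur_weight[OF \<beta> that, of "sqrt \<bar>u\<bar> * b" "y * b + sqrt \<bar>s\<bar> * b'"]
    unfolding S_def by (simp add: case_prod_unfold)
  have "(\<integral>\<^sup>+((u, s, y), (t, w, w'), (k, m, m')).
      ennreal (exp (- (p * (\<bar>u\<bar> + y\<^sup>2) + r * \<bar>s\<bar>
        + (a * (\<bar>t\<bar> + w\<^sup>2 + w'\<^sup>2) + 2 * w * (sqrt \<bar>u\<bar> * b) + 2 * w' * (y * b + sqrt \<bar>s\<bar> * b'))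
        + (c * (\<bar>k\<bar> + m\<^sup>2 + m'\<^sup>2) + 2 * m * (sqrt \<bar>u\<bar> * d) + 2 * m' * (y * d + sqrt \<bar>s\<bar> * d')))))
      \<partial>cyclic_weight \<beta>) =
      (\<integral>\<^sup>+(f, g, h). ennreal (exp (- E0 f)) * (ennreal (exp (- S a b b' (f, g))) * ennreal (exp (- S c d d' (f, h))))
      \<partial>cyclic_weight \<beta>)"
    by (intro nn_integral_cong)
       (auto simp: E0_def S_def algebra_simps simp flip: ennreal_mult' exp_add)
  also have "\<dots> = (\<integral>\<^sup>+f. \<integral>\<^sup>+g. \<integral>\<^sup>+h. ennreal (exp (- E0 f)) *
      (ennreal (exp (- S a b b' (f, g))) * ennreal (exp (- S c d d' (f, h))))
      \<partial>schur_weight \<beta> \<partial>schur_weight \<beta> \<partial>cholesky_weight \<beta>)"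
    unfolding cyclic_weight_def
    by (subst nn_integral_triple) (simp_all add: sigma_finite_schur_weight case_prod_unfold)
  also have "\<dots> = (\<integral>\<^sup>+f. ennreal (exp (- E0 f)) *
      ((\<integral>\<^sup>+g. ennreal (exp (- S a b b' (f, g))) \<partial>schur_weight \<beta>) *
       (\<integral>\<^sup>+h. ennreal (exp (- S c d d' (f, h))) \<partial>schur_weight \<beta>)) \<partial>cholesky_weight \<beta>)"
    by (simp add: nn_integral_cmult nn_integral_multc)
  also have "\<dots> = (\<integral>\<^sup>+(u, s, y). ennreal ((a * c) powr - \<beta>) *
      ennreal (exp (- (P * (\<bar>u\<bar> + y\<^sup>2) + 2 * y * (sqrt \<bar>s\<bar> * Q) + R * \<bar>s\<bar>))) \<partial>cholesky_weight \<beta>)"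
  proof (intro nn_integral_cong, clarsimp simp only: split_paired_all prod.case int_S[OF a] int_S[OF c])
    fix u s y :: real
    \<comment> \<open>\<open>E0\<close> has no cross term, since the vertices 2 and 4 are not
      adjacent; \<open>Q\<close> arises from the corrections alone.\<close>
    have eq: "- E0 (u, s, y) + ((sqrt \<bar>u\<bar> * b)\<^sup>2 + (y * b + sqrt \<bar>s\<bar> * b')\<^sup>2) / a
        + ((sqrt \<bar>u\<bar> * d)\<^sup>2 + (y * d + sqrt \<bar>s\<bar> * d')\<^sup>2) / c =
        - (P * (\<bar>u\<bar> + y\<^sup>2) + 2 * y * (sqrt \<bar>s\<bar> * Q) + R * \<bar>s\<bar>)"
      using a c
      by (simp add: E0_def P_def Q_def R_def power_mult_distrib power2_sum field_simps)
    show "ennreal (exp (- E0 (u, s, y))) *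
        (ennreal (a powr - \<beta> * exp (((sqrt \<bar>u\<bar> * b)\<^sup>2 + (y * b + sqrt \<bar>s\<bar> * b')\<^sup>2) / a)) *
         ennreal (c powr - \<beta> * exp (((sqrt \<bar>u\<bar> * d)\<^sup>2 + (y * d + sqrt \<bar>s\<bar> * d')\<^sup>2) / c))) =
        ennreal ((a * c) powr - \<beta>) *
        ennreal (exp (- (P * (\<bar>u\<bar> + y\<^sup>2) + 2 * y * (sqrt \<bar>s\<bar> * Q) + R * \<bar>s\<bar>)))"
      using a c unfolding eq[symmetric] exp_add
      by (simp add: powr_mult mult_ac flip: ennreal_mult')
  qed
  also have "\<dots> = ennreal ((a * c) powr - \<beta>) * ennreal ((P * R - Q\<^sup>2) powr - \<beta>)"
    using nn_integral_cholesky_weight[OF _ P D, of \<beta>] \<beta>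
    by (simp add: case_prod_unfold nn_integral_cmult)
  also have "\<dots> = ennreal ((a * c * (P * R - Q\<^sup>2)) powr - \<beta>)"
    using a c D by (simp add: powr_mult flip: ennreal_mult')
  finally show ?thesis .
qed

section \<open>Deletion and contraction for the spanning-tree polynomial\<close>

definition adj :: "'v set set \<Rightarrow> ('v \<times> 'v) set" where
  "adj F = {(a, b). {a, b} \<in> F}"

lemma adj_insert: "adj (insert {a, b} F) = insert (a, b) (insert (b, a) (adj F))"
  by (auto simp: adj_def doubleton_eq_iff)

lemma sym_adj_rtrancl: "(u, v) \<in> (adj F)\<^sup>* \<Longrightarrow> (v, u) \<in> (adj F)\<^sup>*"
proof -
  have "sym (adj F)" by (auto simp: sym_def adj_def insert_commute)
  then show "(u, v) \<in> (adj F)\<^sup>* \<Longrightarrow> (v, u) \<in> (adj F)\<^sup>*" by (meson sym_rtrancl symD)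
qed

text \<open>The vertices range over the whole type, so \<open>id\<close> labels the components of
  the empty edge set.\<close>

definition labels_components :: "('v \<Rightarrow> 'l) \<Rightarrow> 'v set set \<Rightarrow> bool" where
  "labels_components L F \<longleftrightarrow> (\<forall>u v. L u = L v \<longleftrightarrow> (u, v) \<in> (adj F)\<^sup>*)"

definition merge_labels :: "'v \<Rightarrow> 'v \<Rightarrow> ('v \<Rightarrow> 'l) \<Rightarrow> 'v \<Rightarrow> 'l" where
  "merge_labels a b L w = (if L w = L b then L a else L w)"

text \<open>Everything labelled like \<open>b\<close> reaches \<open>a\<close> through the new edge.
  Conversely no edge, old or new, changes the merged label, which gives the other direction by
  induction along a walk.\<close>

lemma labels_components_merge:
  assumes L: "labels_components L F"
  shows "labels_components (merge_labels a b L) (insert {a, b} F)"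
  unfolding labels_components_def
proof (intro allI iffI)
  let ?R = "adj (insert {a, b} F)"
  fix u v
  have mono: "(p, q) \<in> ?R\<^sup>*" if "L p = L q" for p q
    using that L rtrancl_mono[of "adj F" ?R] unfolding labels_components_def adj_insert by blast
  have ab: "(a, b) \<in> ?R\<^sup>*" "(b, a) \<in> ?R\<^sup>*" by (auto simp: adj_insert)
  show "(u, v) \<in> ?R\<^sup>*" if "merge_labels a b L u = merge_labels a b L v"
  proof -
    have "(w, a) \<in> ?R\<^sup>*" if "L w = L b" for w
      using mono[OF that] ab(2) by (rule rtrancl_trans)
    then have "(w, a) \<in> ?R\<^sup>* \<and> merge_labels a b L w = L a \<or> merge_labels a b L w = L w" for w
      by (auto simp: merge_labels_def)
    then show ?thesis
      by (metis mono rtrancl_trans sym_adj_rtrancl that)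
  qed
  show "merge_labels a b L u = merge_labels a b L v" if "(u, v) \<in> ?R\<^sup>*"
    using that
  proof (induction rule: rtrancl_induct)
    case (step y z)
    have "L y = L z" if "(y, z) \<in> adj F"
      using L that unfolding labels_components_def by blast
    then have "merge_labels a b L y = merge_labels a b L z"
      using step(2) by (auto simp: adj_insert merge_labels_def)
    then show ?case using step by simp
  qed simp
qed

section \<open>Cycles and paths\<close>

lemma is_cycle_mono: "is_cycle (V, F) p \<Longrightarrow> F \<subseteq> F' \<Longrightarrow> is_cycle (V', F') p"
  by (auto simp: is_cycle_def)

text \<open>The path is built from its end. If the new first vertex already occurs, the path is cut
  back to start at that occurrence.\<close>

lemma simple_path_exists:
  assumes "(u, v) \<in> (adj F)\<^sup>*"
  shows "\<exists>p. p \<noteq> [] \<and> hd p = u \<and> last p = v \<and> distinct p \<and> successively (\<lambda>a b. {a, b} \<in> F) p"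
  using assms
proof (induction rule: converse_rtrancl_induct)
  case base
  show ?case by (intro exI[of _ "[v]"]) simp
next
  case (step y z)
  then obtain p where p: "p \<noteq> []" "hd p = z" "last p = v" "distinct p"
    "successively (\<lambda>a b. {a, b} \<in> F) p" by blast
  show ?case
  proof (cases "y \<in> set p")
    case True
    then obtain q r where "p = q @ y # r" by (auto simp: in_set_conv_decomp)
    then show ?thesis
      using p by (intro exI[of _ "y # r"]) (auto simp: successively_append_iff)
  next
    case False
    then show ?thesis
      using p step(1) by (intro exI[of _ "y # p"]) (auto simp: successively_Cons adj_def)
  qed
qed

text \<open>A simple path from \<open>a\<close> to \<open>b\<close> in \<open>F\<close> is closed up
  by the new edge.\<close>

lemma cycle_of_connected_ends:
  assumes "a \<noteq> b" "{a, b} \<notin> F" "(a, b) \<in> (adj F)\<^sup>*"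
  shows "\<exists>p. is_cycle (V, insert {a, b} F) p"
proof -
  obtain p where p: "p \<noteq> []" "hd p = a" "last p = b" "distinct p"
    "successively (\<lambda>a b. {a, b} \<in> F) p" using simple_path_exists[OF assms(3)] by blast
  \<comment> \<open>One vertex would force \<open>a = b\<close>, and two would put
    \<open>{a, b}\<close> into \<open>F\<close>.\<close>
  have 3: "3 \<le> length p"
  proof (rule ccontr)
    assume "\<not> 3 \<le> length p"
    moreover have "length p \<noteq> 0" using p by simp
    ultimately have "length p = 1 \<or> length p = 2" by linarith
    then show False using p assms by (auto simp: length_Suc_conv numeral_2_eq_2)
  qed
  have "{p ! i, p ! (Suc i mod length p)} \<in> insert {a, b} F" if "i < length p" for i
  proof (cases "Suc i = length p")
    case True
    then have "p ! i = b" "p ! 0 = a"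
      using p by (auto simp: last_conv_nth hd_conv_nth simp flip: True)
    then show ?thesis using True by (simp add: insert_commute)
  next
    case False
    then show ?thesis using that p by (simp add: successively_conv_nth)
  qed
  then show ?thesis using 3 p by (intro exI[of _ p]) (simp add: is_cycle_def)
qed

text \<open>The cycle must use \<open>{a, b}\<close>; going around it the other way joins the ends
  inside \<open>F\<close>.\<close>

lemma cycle_through_edge:
  assumes cyc: "is_cycle (V, insert {a, b} F) p" and no: "\<not> is_cycle (V, F) p"
  shows "(a, b) \<in> (adj F)\<^sup>*"
proof -
  define n where "n = length p"
  have n: "3 \<le> n" "distinct p" and ed: "\<And>i. i < n \<Longrightarrow> {p ! i, p ! (Suc i mod n)} \<in> insert {a, b} F"
    using cyc by (auto simp: is_cycle_def n_def)
  obtain i where i: "i < n" "{p ! i, p ! (Suc i mod n)} = {a, b}"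
    using no cyc by (auto simp: is_cycle_def n_def)
  \<comment> \<open>A cycle of length at least 3 uses each edge once; for length 2 both index pairs
    would give the same edge.\<close>
  have other: "{p ! j, p ! (Suc j mod n)} \<in> F" if j: "j < n" "j \<noteq> i" for j
  proof -
    have lt: "Suc j mod n < n" "Suc i mod n < n" using n by auto
    have False if eq: "{p ! j, p ! (Suc j mod n)} = {p ! i, p ! (Suc i mod n)}"
    proof -
      have "j = Suc i mod n \<and> Suc j mod n = i"
        using eq j i lt n by (auto simp: doubleton_eq_iff nth_eq_iff_index_eq n_def)
      then show False using n i j by (auto simp: mod_Suc split: if_splits)
    qed
    then show ?thesis using ed[OF j(1)] i by auto
  qed
  \<comment> \<open>Starting just after edge \<open>i\<close>, fewer than \<open>n\<close> steps
    never traverse edge \<open>i\<close>; after \<open>n - 1\<close> steps the walk is at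
    \<open>p ! i\<close>.\<close>
  have step: "(p ! (Suc i mod n), p ! ((Suc i + k) mod n)) \<in> (adj F)\<^sup>*" if "k < n" for k
    using that
  proof (induction k)
    case (Suc k)
    define j where "j = (Suc i + k) mod n"
    have "j < n" using n by (simp add: j_def)
    moreover have "j \<noteq> i"
    proof -
      have "j = (if Suc i + k < n then Suc i + k else Suc i + k - n)"
        using i Suc.prems by (simp add: j_def mod_if)
      then show ?thesis using Suc.prems by (auto split: if_splits)
    qed
    ultimately have "{p ! j, p ! (Suc j mod n)} \<in> F" by (rule other)
    moreover have "Suc j mod n = (Suc i + Suc k) mod n" by (simp add: j_def mod_Suc_eq)
    ultimately have "(p ! j, p ! ((Suc i + Suc k) mod n)) \<in> adj F" by (simp add: adj_def)
    then show ?case using Suc by (simp add: j_def rtrancl.rtrancl_into_rtrancl)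
  qed simp
  have "(Suc i + (n - 1)) mod n = i" using i n by simp
  then have "(p ! (Suc i mod n), p ! i) \<in> (adj F)\<^sup>*" using step[of "n - 1"] n by simp
  then show ?thesis using i(2) sym_adj_rtrancl by (fastforce simp: doubleton_eq_iff)
qed

section \<open>The deletion-contraction recursion\<close>

text \<open>The first summand deletes the edge and the second contracts it. Contraction changes only
  the labels, so the recursion can be evaluated by rewriting; an edge that has become a loop
  contributes nothing.\<close>

fun tree_sum :: "('v set \<Rightarrow> real) \<Rightarrow> 'v set \<Rightarrow> ('v \<Rightarrow> 'l) \<Rightarrow> ('v \<times> 'v) list \<Rightarrow> real" where
  "tree_sum x V L [] = (if \<forall>u\<in>V. \<forall>v\<in>V. L u = L v then 1 else 0)"
| "tree_sum x V L ((a, b) # es) = tree_sum x V L es +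
     (if L a = L b then 0 else x {a, b} * tree_sum x V (merge_labels a b L) es)"

definition edge_list :: "('v \<times> 'v) list \<Rightarrow> 'v set list" where
  "edge_list es = map (\<lambda>(a, b). {a, b}) es"

text \<open>
  The induction contracts the chosen edges \<open>F\<close>: an edge may be added to a forest precisely when it
  joins two components.
\<close>

lemma tree_sum_correct:
  assumes "V \<noteq> {}" "labels_components L F" "\<nexists>p. is_cycle (V, F) p"
    and "\<forall>(a, b) \<in> set es. a \<noteq> b" "distinct (edge_list es)" "set (edge_list es) \<inter> F = {}"
  shows "(\<Sum>S | S \<subseteq> set (edge_list es) \<and> is_tree (V, F \<union> S). \<Prod>e\<in>S. x e) = tree_sum x V L es"
  using assms(2-)
proof (induction es arbitrary: F L)
  case Nil
  have tree: "is_tree (V, F) \<longleftrightarrow> (\<forall>u\<in>V. \<forall>v\<in>V. L u = L v)"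
  proof -
    have "connected_graph (V, F) \<longleftrightarrow> (\<forall>u\<in>V. \<forall>v\<in>V. (u, v) \<in> (adj F)\<^sup>*)"
      unfolding connected_graph_def adj_def fst_conv snd_conv using assms(1) by blast
    also have "\<dots> \<longleftrightarrow> (\<forall>u\<in>V. \<forall>v\<in>V. L u = L v)"
      using Nil(1) unfolding labels_components_def by blast
    finally show ?thesis using Nil(2) unfolding is_tree_def by blast
  qed
  have "{S. S \<subseteq> set (edge_list []) \<and> is_tree (V, F \<union> S)} =
      (if is_tree (V, F) then {{}} else {})"
    by (auto simp: edge_list_def)
  then show ?case unfolding tree_sum.simps tree[symmetric] by simp
next
  case (Cons e es)
  obtain a b where e: "e = (a, b)" by (cases e)
  define E where "E = set (edge_list es)"
  have "finite E" by (simp add: E_def)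
  have new: "a \<noteq> b" "{a, b} \<notin> E" "{a, b} \<notin> F" and E: "set (edge_list (e # es)) = insert {a, b} E"
    using Cons.prems by (auto simp: e edge_list_def E_def)
  define A where "A = {S. S \<subseteq> E \<and> is_tree (V, F \<union> S)}"
  define B where "B = {S. S \<subseteq> E \<and> is_tree (V, insert {a, b} F \<union> S)}"
  \<comment> \<open>The trees are sorted by whether they use \<open>{a, b}\<close>.\<close>
  have split: "{S. S \<subseteq> insert {a, b} E \<and> is_tree (V, F \<union> S)} = A \<union> insert {a, b} ` B"
  proof (intro equalityI subsetI)
    fix S assume S: "S \<in> {S. S \<subseteq> insert {a, b} E \<and> is_tree (V, F \<union> S)}"
    show "S \<in> A \<union> insert {a, b} ` B"
    proof (cases "{a, b} \<in> S")
      case True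
      then have "S = insert {a, b} (S - {{a, b}})" by auto
      moreover have "S - {{a, b}} \<in> B"
      proof -
        have "insert {a, b} F \<union> (S - {{a, b}}) = F \<union> S" using True by auto
        then show ?thesis using S unfolding B_def by auto
      qed
      ultimately show ?thesis by blast
    qed (use S A_def in auto)
  qed (auto simp: A_def B_def)
  have finA: "finite A" and finB: "finite B"
    using \<open>finite E\<close> by (auto simp: A_def B_def)
  have inj: "inj_on (insert {a, b}) B"
  proof (rule inj_onI)
    fix S T assume ST: "S \<in> B" "T \<in> B" and eq: "insert {a, b} S = insert {a, b} T"
    have "{a, b} \<notin> S" "{a, b} \<notin> T" using ST new(2) by (auto simp: B_def)
    then show "S = T" using eq insert_ident by metis
  qed
  have disj: "A \<inter> insert {a, b} ` B = {}" using new(2) by (auto simp: A_def)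
  have "(\<Sum>S\<in>A \<union> insert {a, b} ` B. \<Prod>e\<in>S. x e) =
      (\<Sum>S\<in>A. \<Prod>e\<in>S. x e) + (\<Sum>S\<in>insert {a, b} ` B. \<Prod>e\<in>S. x e)"
    using finA finB disj by (intro sum.union_disjoint) auto
  also have "(\<Sum>S\<in>insert {a, b} ` B. \<Prod>e\<in>S. x e) = (\<Sum>S\<in>B. x {a, b} * (\<Prod>e\<in>S. x e))"
    unfolding sum.reindex[OF inj] comp_def
  proof (intro sum.cong refl)
    fix S assume "S \<in> B"
    then have "finite S" "{a, b} \<notin> S" using new(2) finite_subset[OF _ \<open>finite E\<close>] by (auto simp: B_def)
    then show "prod x (insert {a, b} S) = x {a, b} * prod x S" by simp
  qed
  also have "(\<Sum>S\<in>A. \<Prod>e\<in>S. x e) = tree_sum x V L es"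
    unfolding A_def E_def using Cons.prems by (intro Cons.IH) (auto simp: edge_list_def)
  also have "(\<Sum>S\<in>B. x {a, b} * (\<Prod>e\<in>S. x e)) =
      (if L a = L b then 0 else x {a, b} * tree_sum x V (merge_labels a b L) es)"
  proof (cases "L a = L b")
    \<comment> \<open>The edge would close a cycle with the edges contracted so far, so no tree
      contains it.\<close>
    case True
    then have "(a, b) \<in> (adj F)\<^sup>*" using Cons.prems(1) by (simp add: labels_components_def)
    then obtain p where p: "is_cycle (V, insert {a, b} F) p"
      using cycle_of_connected_ends new by metis
    have "B = {}" using is_cycle_mono[OF p] unfolding B_def is_tree_def by blast
    then show ?thesis using True by simp
  next
    case False
    then have "(a, b) \<notin> (adj F)\<^sup>*" using Cons.prems(1) by (simp add: labels_components_def)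
    then have "\<nexists>p. is_cycle (V, insert {a, b} F) p"
      using cycle_through_edge Cons.prems(2) by metis
    then have "(\<Sum>S\<in>B. \<Prod>e\<in>S. x e) = tree_sum x V (merge_labels a b L) es"
      unfolding B_def E_def using Cons.prems new
      by (intro Cons.IH labels_components_merge) (auto simp: edge_list_def E_def)
    then show ?thesis using False by (simp add: sum_distrib_left[symmetric])
  qed
  finally show ?case unfolding E split by (simp add: e)
qed

lemma tree_poly_eq_tree_sum:
  assumes "V \<noteq> {}" "\<forall>(a, b) \<in> set es. a \<noteq> b" "distinct (edge_list es)"
  shows "tree_poly (V, set (edge_list es)) x = tree_sum x V id es"
proof -
  have "\<nexists>p. is_cycle (V, {} :: 'a set set) p" by (auto simp: is_cycle_def intro: exI[of _ 0])
  moreover have "labels_components id ({} :: 'a set set)"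
    by (auto simp: labels_components_def adj_def)
  ultimately show ?thesis
    using tree_sum_correct[of V id "{}" es x] assms
    by (simp add: tree_poly_def spanning_trees_def)
qed

lemma tree_poly_W4:
  "tree_poly W4 x = tree_sum x {0,1,2,3,4} id [(0,1),(0,2),(0,3),(0,4),(1,2),(2,3),(3,4),(4,1)]"
proof -
  let ?es = "[(0,1),(0,2),(0,3),(0,4),(1,2),(2,3),(3,4),(4,1)] :: (nat \<times> nat) list"
  have "W4 = ({0,1,2,3,4}, set (edge_list ?es))" by (simp add: W4_def edge_list_def)
  moreover have "distinct (edge_list ?es)" by (simp add: edge_list_def doubleton_eq_iff)
  ultimately show ?thesis using tree_poly_eq_tree_sum[of "{0,1,2,3,4}" ?es x] by simp
qed

text \<open>
  The right-hand side is \<open>u v det D\<close> for the Schur complement \<open>D\<close>, with the denominators cleared.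
\<close>

lemma tree_poly_W4_schur:
  fixes x :: "nat set \<Rightarrow> real"
  defines "u \<equiv> x {0,1} + x {1,2} + x {4,1}" and "v \<equiv> x {0,3} + x {2,3} + x {3,4}"
    and "p \<equiv> x {0,2} + x {1,2} + x {2,3}" and "r \<equiv> x {0,4} + x {3,4} + x {4,1}"
  shows "tree_poly W4 x = u * v * p * r
    - p * (u * (x {3,4})\<^sup>2 + v * (x {4,1})\<^sup>2) - r * (u * (x {2,3})\<^sup>2 + v * (x {1,2})\<^sup>2)
    + (x {1,2} * x {3,4} - x {2,3} * x {4,1})\<^sup>2"
  unfolding tree_poly_W4 u_def v_def p_def r_def
  \<comment> \<open>The first call runs the recursion; the second compares the two
    polynomials.\<close>
  by (simp add: merge_labels_def) (simp add: algebra_simps power2_eq_square)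

section \<open>The wheel with four spokes\<close>

text \<open>
  The coefficients of the variables \<open>x e\<close> in the exponent of \<open>nn_integral_cyclic_weight\<close>.
\<close>

definition W4_coeff :: "nat set \<Rightarrow>
    (real \<times> real \<times> real) \<times> (real \<times> real \<times> real) \<times> (real \<times> real \<times> real) \<Rightarrow> real" where
  "W4_coeff e = (\<lambda>((u, s, y), (t, w, w'), (k, m, m')).
     if e = {0,1} then \<bar>t\<bar> + w\<^sup>2 + w'\<^sup>2
     else if e = {0,2} then \<bar>u\<bar> + y\<^sup>2
     else if e = {0,3} then \<bar>k\<bar> + m\<^sup>2 + m'\<^sup>2
     else if e = {0,4} then \<bar>s\<bar>
     else if e = {1,2} then \<bar>t\<bar> + (w - sqrt \<bar>u\<bar>)\<^sup>2 + (w' - y)\<^sup>2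
     else if e = {2,3} then \<bar>k\<bar> + (m - sqrt \<bar>u\<bar>)\<^sup>2 + (m' - y)\<^sup>2
     else if e = {3,4} then \<bar>k\<bar> + m\<^sup>2 + (m' - sqrt \<bar>s\<bar>)\<^sup>2
     else \<bar>t\<bar> + w\<^sup>2 + (w' - sqrt \<bar>s\<bar>)\<^sup>2)"

lemma W4_coeff_nonneg: "0 \<le> W4_coeff e \<omega>"
  by (auto simp: W4_coeff_def split: prod.split)

lemma W4_coeff_measurable: "W4_coeff e \<in> borel_measurable (cyclic_weight \<beta>)"
  unfolding W4_coeff_def case_prod_unfold by measurable

lemma sum_edges_W4:
  "(\<Sum>e\<in>edges W4. f e) = f {0,1} + f {0,2} + f {0,3} + f {0,4} + f {1,2} + f {2,3} + f {3,4} + f {4,1}"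
  by (simp add: W4_def doubleton_eq_iff add_ac)

text \<open>Each rim coefficient expands into the terms of its two end vertices and a cross term.
  Collecting by vertices gives the weighted degrees on the diagonal and the negated rim variables
  off it, as in the reduced Laplacian.\<close>

lemma phase_W4:
  fixes x :: "nat set \<Rightarrow> real"
  defines "a \<equiv> x {0,1} + x {1,2} + x {4,1}" and "c \<equiv> x {0,3} + x {2,3} + x {3,4}"
    and "p \<equiv> x {0,2} + x {1,2} + x {2,3}" and "r \<equiv> x {0,4} + x {3,4} + x {4,1}"
  shows "(\<Sum>e\<in>edges W4. x e * W4_coeff e ((u, s, y), (t, w, w'), (k, m, m'))) =
      p * (\<bar>u\<bar> + y\<^sup>2) + r * \<bar>s\<bar>
        + (a * (\<bar>t\<bar> + w\<^sup>2 + w'\<^sup>2) + 2 * w * (sqrt \<bar>u\<bar> * - x {1,2})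
            + 2 * w' * (y * - x {1,2} + sqrt \<bar>s\<bar> * - x {4,1}))
        + (c * (\<bar>k\<bar> + m\<^sup>2 + m'\<^sup>2) + 2 * m * (sqrt \<bar>u\<bar> * - x {2,3})
            + 2 * m' * (y * - x {2,3} + sqrt \<bar>s\<bar> * - x {3,4}))"
  unfolding sum_edges_W4 a_def c_def p_def r_def W4_coeff_def
  by (simp add: doubleton_eq_iff power2_diff) (simp add: algebra_simps)

text \<open>It remains to see that the Schur complement is positive definite, which follows from
  strict diagonal dominance.\<close>

lemma nn_integral_W4:
  assumes \<beta>: "1 < \<beta>" and x: "x \<in> pos_orthant (edges W4)"
  shows "(\<integral>\<^sup>+\<omega>. ennreal (exp (- (\<Sum>e\<in>edges W4. x e * W4_coeff e \<omega>))) \<partial>cyclic_weight \<beta>) =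
    ennreal (tree_poly W4 x powr - \<beta>)"
proof -
  have pos: "0 < x {0,1}" "0 < x {0,2}" "0 < x {0,3}" "0 < x {0,4}"
      "0 < x {1,2}" "0 < x {2,3}" "0 < x {3,4}" "0 < x {4,1}"
    using pos_orthantD[OF x] by (auto simp: W4_def)
  define a where "a = x {0,1} + x {1,2} + x {4,1}"
  define c where "c = x {0,3} + x {2,3} + x {3,4}"
  define p where "p = x {0,2} + x {1,2} + x {2,3}"
  define r where "r = x {0,4} + x {3,4} + x {4,1}"
  define P where "P = p - (- x {1,2})\<^sup>2 / a - (- x {2,3})\<^sup>2 / c"
  define R where "R = r - (- x {4,1})\<^sup>2 / a - (- x {3,4})\<^sup>2 / c"
  define Q where "Q = - (- x {1,2} * - x {4,1} / a + - x {2,3} * - x {3,4} / c)"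
  have ac: "0 < a" "0 < c" using pos by (auto simp: a_def c_def)
  have Q: "0 \<le> - Q" using pos ac by (simp add: Q_def)
  \<comment> \<open>After elimination \<open>- Q\<close> is the weight of an effective edge between
    2 and 4, and the bracket is the effective weight from 2 to the hub. The identity follows by
    expanding \<open>x {1,2} = x {1,2} * a / a\<close> and likewise for
    \<open>x {2,3}\<close>.\<close>
  have "P = - Q + (x {0,2} + x {1,2} * x {0,1} / a + x {2,3} * x {0,3} / c)"
  proof -
    have "x {1,2} = (x {1,2} * x {0,1} + (x {1,2})\<^sup>2 + x {1,2} * x {4,1}) / a"
      using ac unfolding a_def by (simp add: field_simps power2_eq_square)
    moreover have "x {2,3} = (x {2,3} * x {0,3} + (x {2,3})\<^sup>2 + x {2,3} * x {3,4}) / c"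
      using ac unfolding c_def by (simp add: field_simps power2_eq_square)
    ultimately show ?thesis unfolding P_def Q_def p_def add_divide_distrib by simp
  qed
  moreover have "0 < x {0,2} + x {1,2} * x {0,1} / a + x {2,3} * x {0,3} / c"
    using pos ac by (intro add_pos_pos) auto
  ultimately have PQ: "- Q < P" by linarith
  have "R = - Q + (x {0,4} + x {4,1} * x {0,1} / a + x {3,4} * x {0,3} / c)"
  proof -
    have "x {4,1} = (x {4,1} * x {0,1} + (x {4,1})\<^sup>2 + x {1,2} * x {4,1}) / a"
      using ac unfolding a_def by (simp add: field_simps power2_eq_square)
    moreover have "x {3,4} = (x {3,4} * x {0,3} + (x {3,4})\<^sup>2 + x {2,3} * x {3,4}) / c"
      using ac unfolding c_def by (simp add: field_simps power2_eq_square)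
    ultimately show ?thesis unfolding R_def Q_def r_def add_divide_distrib by simp
  qed
  moreover have "0 < x {0,4} + x {4,1} * x {0,1} / a + x {3,4} * x {0,3} / c"
    using pos ac by (intro add_pos_pos) auto
  ultimately have RQ: "- Q < R" by linarith
  \<comment> \<open>Multiply \<open>- Q < P\<close> and \<open>- Q < R\<close>, where
    \<open>- Q\<close> is nonnegative.\<close>
  have D: "0 < P * R - Q\<^sup>2"
    using mult_strict_mono'[OF PQ RQ Q Q] by (simp add: power2_eq_square)
  have "tree_poly W4 x = a * c * (P * R - Q\<^sup>2)"
    unfolding tree_poly_W4_schur P_def R_def Q_def a_def[symmetric] c_def[symmetric]
      p_def[symmetric] r_def[symmetric]
    using ac by (simp add: power2_eq_square field_simps)
  moreover have "(\<integral>\<^sup>+\<omega>. ennreal (exp (- (\<Sum>e\<in>edges W4. x e * W4_coeff e \<omega>))) \<partial>cyclic_weight \<beta>) =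
      ennreal ((a * c * (P * R - Q\<^sup>2)) powr - \<beta>)"
  proof -
    have 0: "0 < P" using PQ Q by linarith
    show ?thesis
      unfolding nn_integral_cyclic_weight[OF \<beta> ac, of p "- x {1,2}" "- x {2,3}" r "- x {4,1}" "- x {3,4}",
          folded P_def R_def Q_def, OF 0 D, symmetric]
      by (intro nn_integral_cong)
         (clarify, simp only: phase_W4 prod.case flip: a_def c_def p_def r_def)
  qed
  ultimately show ?thesis by simp
qed

lemma completely_monotone_W4:
  assumes \<beta>: "1 < \<beta>"
  shows "completely_monotone (edges W4) (\<lambda>x. tree_poly W4 x powr - \<beta>)"
proof -
  interpret laplace_integral "cyclic_weight \<beta>" "edges W4" W4_coeff
    by unfold_locales (auto simp: W4_def W4_coeff_nonneg W4_coeff_measurable)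
  \<comment> \<open>A finite value of the nonnegative integral yields both integrability, hence
    admissibility of the constant 1, and the representation as a transform.\<close>
  have int: "has_bochner_integral (cyclic_weight \<beta>) (\<lambda>\<omega>. exp (- phase x \<omega>)) (tree_poly W4 x powr - \<beta>)"
    if "x \<in> pos_orthant (edges W4)" for x
    using nn_integral_W4[OF \<beta> that]
    by (intro has_bochner_integral_nn_integral) (simp_all add: phase_def)
  show ?thesis
  proof (rule completely_monotone_transform)
    show "admissible (\<lambda>_. 1)" using int by (auto simp: admissible_def has_bochner_integral_iff)
    show "tree_poly W4 x powr - \<beta> = transform (\<lambda>_. 1) x" if "x \<in> pos_orthant (edges W4)" for x
      using int[OF that] by (simp add: transform_def has_bochner_integral_iff)
  qed
qed

lemma finite_graph_W4: "finite_graph W4"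
  by (simp add: finite_graph_def W4_def)

lemma connected_graph_W4: "connected_graph W4"
proof -
  have hub: "(0, v) \<in> (adj (edges W4))\<^sup>*" if "v \<in> vertices W4" for v
    using that by (cases "v = 0") (auto simp: W4_def adj_def intro!: r_into_rtrancl)
  then have "(u, v) \<in> (adj (edges W4))\<^sup>*" if "u \<in> vertices W4" "v \<in> vertices W4" for u v
    using that by (meson rtrancl_trans sym_adj_rtrancl)
  moreover have "vertices W4 \<noteq> {}" by (simp add: W4_def)
  ultimately show ?thesis unfolding connected_graph_def adj_def by blast
qed

theorem corollary7p3:
  "(\<forall>\<beta>::real. 1 < \<beta> \<longrightarrow>
      completely_monotone (edges W4) (\<lambda>x. tree_poly W4 x powr (- \<beta>)))
   \<and> (\<forall>\<beta>::real. 1 < \<beta> \<and> \<beta> < 3 / 2 \<longrightarrow> W4 \<in> cm_graphs \<beta>)"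
  by (simp add: completely_monotone_W4 cm_graphs_def finite_graph_W4 connected_graph_W4)

end
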